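(* Consider the erosion network process with parameter $\eta>0$ defined in the context. For any node $v\in\mathbb{Z}^2_{even}$ of depth at least 2, the sequence $A_v(n)=\frac{T_v(n-1)}{n}$ has a limit as $n\to\infty$ almost surely. Therefore, almost surely, the flood ratios $F_v(n)=\frac{I_v(n)}{A_v(n)}$ satisfy $$\liminf_{n\to\infty}F_v(n)<\limsup_{n\to\infty}F_v(n).$$
   Context: Model. Fix $\eta>0$. Nodes are the points of $\mathbb{Z}^2_{even}=\{(x,y)\in\mathbb{Z}^2: x+y\text{ even},\ y\le 0\}$. A node $v=(x,y)$ has depth $1-y$; if its depth is at least 2 it has left parent $w_1=(x-1,y+1)$ and right parent $w_2=(x+1,y+1)$. For every node $v$ set $T_v^L(0)=T_v(0)=0$, $I_v(0)=1$, $P_v^L(0)=1/2$. For $n\ge1$, given $\mathcal{F}_{n-1}=\sigma(\{D_u^L(k): u\in\mathbb{Z}^2_{even},\,1\le k\le n-1\})$, the variables $\{D_v^L(n)\}_v$ are conditionally independent Bernoulli ($\{0,1\}$-valued) with $\mathbb{P}(D_v^L(n)=1\mid\mathcal{F}_{n-1})=P_v^L(n-1)$. Then $$T_v^L(n)=T_v^L(n-1)+I_v(n-1)D_v^L(n),\quad T_v(n)=T_v(n-1)+I_v(n-1),\quad P_v^L(n)=\frac{T_v^L(n)+\eta}{T_v(n)+2\eta},$$ and $I_v(n)=1$ if $v$ has depth 1, while otherwise $I_v(n)=I_{w_1}(n-1)(1-D_{w_1}^L(n))+I_{w_2}(n-1)D_{w_2}^L(n)+1$. The flood ratio $F_v(n)$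 is considered for $n\ge2$, where $A_v(n)>0$. *)

theory Defs
  imports "HOL-Probability.Probability"
begin

definition cond_pr :: "'a measure \<Rightarrow> 'a measure \<Rightarrow> 'a set \<Rightarrow> 'a \<Rightarrow> real" where
  "cond_pr M F E = real_cond_exp M F (indicator E)"

definition cond_indep_vars ::
  "'a measure \<Rightarrow> 'a measure \<Rightarrow> ('i \<Rightarrow> 'b measure) \<Rightarrow> ('i \<Rightarrow> 'a \<Rightarrow> 'b) \<Rightarrow> 'i set \<Rightarrow> bool" where
  "cond_indep_vars M F N X J \<longleftrightarrow>
     (\<forall>j\<in>J. X j \<in> measurable M (N j)) \<and>
     (\<forall>K A. K \<subseteq> J \<longrightarrow> finite K \<longrightarrow> K \<noteq> {} \<longrightarrow> (\<forall>j\<in>K. A j \<in> sets (N j)) \<longrightarrow>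
       (AE \<omega> in M. cond_pr M F {\<omega>' \<in> space M. \<forall>j\<in>K. X j \<omega>' \<in> A j} \<omega>
                 = (\<Prod>j\<in>K. cond_pr M F {\<omega>' \<in> space M. X j \<omega>' \<in> A j} \<omega>)))"

type_synonym node = "int \<times> int"

definition nodes :: "node set" where
  "nodes = {(x, y). even (x + y) \<and> y \<le> 0}"

definition depth :: "node \<Rightarrow> int" where
  "depth v = 1 - snd v"

definition left_parent :: "node \<Rightarrow> node" where
  "left_parent v = (fst v - 1, snd v + 1)"

definition right_parent :: "node \<Rightarrow> node" where
  "right_parent v = (fst v + 1, snd v + 1)"

text \<open>
  Everything is a function of the family \<open>D v n \<omega>\<close> (the variables \<open>D_v^L(n)\<close>, used for
  \<open>n \<ge> 1\<close> only). Below, \<open>inflow\<close>, \<open>total\<close>, \<open>total_left\<close> and \<open>prob_left\<close> are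
  \<open>I_v(n)\<close>, \<open>T_v(n)\<close>, \<open>T_v^L(n)\<close> and \<open>P_v^L(n)\<close>. They are total functions on
  \<open>int \<times> int\<close>, but for \<open>v \<in> nodes\<close> the recursion only visits elements of \<open>nodes\<close>.
\<close>

fun inflow :: "(node \<Rightarrow> nat \<Rightarrow> 'a \<Rightarrow> real) \<Rightarrow> node \<Rightarrow> nat \<Rightarrow> 'a \<Rightarrow> real" where
  "inflow D v 0 \<omega> = 1"
| "inflow D v (Suc n) \<omega> =
     (if depth v = 1 then 1
      else inflow D (left_parent v) n \<omega> * (1 - D (left_parent v) (Suc n) \<omega>)
         + inflow D (right_parent v) n \<omega> * D (right_parent v) (Suc n) \<omega> + 1)"

fun total_left :: "(node \<Rightarrow> nat \<Rightarrow> 'a \<Rightarrow> real) \<Rightarrow> node \<Rightarrow> nat \<Rightarrow> 'a \<Rightarrow> real" where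
  "total_left D v 0 \<omega> = 0"
| "total_left D v (Suc n) \<omega> = total_left D v n \<omega> + inflow D v n \<omega> * D v (Suc n) \<omega>"

fun total :: "(node \<Rightarrow> nat \<Rightarrow> 'a \<Rightarrow> real) \<Rightarrow> node \<Rightarrow> nat \<Rightarrow> 'a \<Rightarrow> real" where
  "total D v 0 \<omega> = 0"
| "total D v (Suc n) \<omega> = total D v n \<omega> + inflow D v n \<omega>"

fun prob_left :: "real \<Rightarrow> (node \<Rightarrow> nat \<Rightarrow> 'a \<Rightarrow> real) \<Rightarrow> node \<Rightarrow> nat \<Rightarrow> 'a \<Rightarrow> real" where
  "prob_left \<eta> D v 0 \<omega> = 1 / 2"
| "prob_left \<eta> D v (Suc n) \<omega> =
     (total_left D v (Suc n) \<omega> + \<eta>) / (total D v (Suc n) \<omega> + 2 * \<eta>)"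

definition history :: "'a measure \<Rightarrow> (node \<Rightarrow> nat \<Rightarrow> 'a \<Rightarrow> real) \<Rightarrow> nat \<Rightarrow> 'a measure" where
  "history M D n =
     sigma (space M) {D u k -` B \<inter> space M | u k B. u \<in> nodes \<and> 1 \<le> k \<and> k \<le> n \<and> B \<in> sets borel}"

locale erosion_network = prob_space M for M :: "'a measure" +
  fixes \<eta> :: real and D :: "node \<Rightarrow> nat \<Rightarrow> 'a \<Rightarrow> real"
  assumes eta_pos: "\<eta> > 0"
    and D_measurable: "\<And>v n. v \<in> nodes \<Longrightarrow> n \<ge> 1 \<Longrightarrow> D v n \<in> borel_measurable M"
    and D_01: "\<And>v n \<omega>. v \<in> nodes \<Longrightarrow> n \<ge> 1 \<Longrightarrow> \<omega> \<in> space M \<Longrightarrow> D v n \<omega> \<in> {0, 1}"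
    and D_cond_indep: "\<And>n. n \<ge> 1 \<Longrightarrow>
      cond_indep_vars M (history M D (n - 1)) (\<lambda>_. borel) (\<lambda>v. D v n) nodes"
    and D_cond_prob: "\<And>v n. v \<in> nodes \<Longrightarrow> n \<ge> 1 \<Longrightarrow>
      AE \<omega> in M. cond_pr M (history M D (n - 1)) {\<omega>' \<in> space M. D v n \<omega>' = 1} \<omega>
               = prob_left \<eta> D v (n - 1) \<omega>"
begin

text \<open>This side condition makes the \<open>real_cond_exp\<close> in \<open>cond_pr\<close> meaningful.\<close>

lemma subalgebra_history: "subalgebra M (history M D n)"
proof -
  have "{D u k -` B \<inter> space M | u k B. u \<in> nodes \<and> 1 \<le> k \<and> k \<le> n \<and> B \<in> sets borel} \<subseteq> sets M"
    using D_measurable by (auto intro!: measurable_sets)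
  then show ?thesis
    unfolding subalgebra_def history_def
    by (simp add: space_measure_of_conv sets_measure_of_conv sets.sigma_sets_subset)
qed

end

text \<open>
  These are meant for \<open>n \<ge> 1\<close> and \<open>n \<ge> 2\<close> respectively; the junk values at smaller \<open>n\<close>
  (truncated subtraction, division by zero) do not affect statements about \<open>n \<longrightarrow> \<infinity>\<close>.
\<close>

definition average_flow :: "(node \<Rightarrow> nat \<Rightarrow> 'a \<Rightarrow> real) \<Rightarrow> node \<Rightarrow> nat \<Rightarrow> 'a \<Rightarrow> real" where
  "average_flow D v n \<omega> = total D v (n - 1) \<omega> / real n"

definition flood_ratio :: "(node \<Rightarrow> nat \<Rightarrow> 'a \<Rightarrow> real) \<Rightarrow> node \<Rightarrow> nat \<Rightarrow> 'a \<Rightarrow> real" where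
  "flood_ratio D v n \<omega> = inflow D v n \<omega> / average_flow D v n \<omega>"

end

theory Submission
  imports Defs
begin

text \<open>
  Each node is an urn: \<open>P_v\<close> is a martingale whose increments are \<open>O(1/n)\<close>, since the inflow lies
  between 1 and a bound depending on the depth. Hence \<open>P_v(n)\<close> converges almost surely, and
  since \<open>T_v(n+1) = n + 1 + (T_{w_1}(n) - T_{w_1}^L(n)) + T_{w_2}^L(n)\<close>, the averages \<open>A_v\<close>
  converge by induction on the depth. The limit of \<open>P_v\<close> is not 0, because
  \<open>ln (1 / P_v) + K / (T_v^L + \<eta>)\<close> is a nonnegative supermartingale, and by symmetry it is not 1.
  So the conditional probabilities of \<open>(D_{w_1}, D_{w_2}) = (1, 0)\<close> and \<open>(0, 1)\<close> have positive
  limits, both events occur infinitely often, and \<open>I_v\<close> takes the value 1 and values \<open>\<ge> 3\<close>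
  infinitely often.
\<close>

text \<open>Convergence of \<open>P_v\<close> rests on orthogonality: the martingale increments are
  pairwise orthogonal, and their size O(1/n) makes the sums over blocks between consecutive cubes
  absolutely summable in mean, while the movement inside a block tends to 0. The same summability
  result, with weight 1/(n+1), drives the conditional Borel-Cantelli argument.

  The obstacle is a limit of \<open>P_v\<close> at 0 or 1, where one of the two routing outcomes
  could die out. The amount added to the urn of a node depends on the random history of its
  ancestors, so the limit has no explicit law to consult. Instead \<open>ln (1 / P_v)\<close> is
  kept bounded in expectation; by Fatou its liminf is then finite almost surely, which excludes the
  limit 0. The drift of the logarithm alone may be positive, because
  \<open>ln (L + I) - ln L\<close> can fall short of \<open>I / L\<close>; the term
  \<open>K / L\<close>, with \<open>K\<close> a bound on the inflow, covers the largest possible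
  gap, \<open>I / L - I / (L + I)\<close>.\<close>

text \<open>Both bounds are \<open>ln z \<le> z - 1\<close>, at \<open>z = x / (x + y)\<close> and
  at \<open>z = (x + y) / x\<close>.\<close>

lemma ln_add_ge:
  fixes x y :: real
  assumes "0 < x" and "0 \<le> y"
  shows "y / (x + y) \<le> ln (x + y) - ln x" and "ln (x + y) - ln x \<le> y / x"
proof -
  have "ln x - ln (x + y) = ln (x / (x + y))"
    using assms by (simp add: ln_div)
  also have "\<dots> \<le> x / (x + y) - 1"
    using assms by (intro ln_le_minus_one) auto
  also have "\<dots> = - (y / (x + y))"
    using assms by (simp add: field_simps)
  finally show "y / (x + y) \<le> ln (x + y) - ln x" by simp
  have "ln (x + y) - ln x = ln ((x + y) / x)"
    using assms by (simp add: ln_div)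
  also have "\<dots> \<le> (x + y) / x - 1"
    using assms by (intro ln_le_minus_one) auto
  also have "\<dots> = y / x"
    using assms by (simp add: field_simps)
  finally show "ln (x + y) - ln x \<le> y / x" .
qed

section \<open>Series with orthogonal terms of size O(1/n)\<close>

text \<open>For j \<ge> 1, block j has 3j^2 + 3j + 1 \<le> 7j^2 terms, each at most K/j^3, so
  partial sums move by at most 7K/j inside it and convergence along cubes extends to all indices.
  Doubling blocks would be too long: terms of size 1/n can add up to a constant over each of
  them.\<close>

lemma summable_of_cubic_blocks:
  fixes x :: "nat \<Rightarrow> real"
  assumes bound: "\<And>n. \<bar>x n\<bar> \<le> K / real (Suc n)"
    and blocks: "summable (\<lambda>j. \<Sum>k = j ^ 3..<Suc j ^ 3. x k)"
  shows "summable x"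
proof -
  define s where "s n = (\<Sum>k<n. x k)" for n
  have mono3: "j ^ 3 \<le> Suc j ^ 3" for j :: nat
    by (rule power_mono) auto
  have K0: "0 \<le> K"
    using bound[of 0] by simp
  have s_cube: "s (j ^ 3) = (\<Sum>i<j. \<Sum>k = i ^ 3..<Suc i ^ 3. x k)" for j
  proof (induction j)
    case 0
    then show ?case by (simp add: s_def)
  next
    case (Suc j)
    have "s (Suc j ^ 3) = s (j ^ 3) + (\<Sum>k = j ^ 3..<Suc j ^ 3. x k)"
      unfolding s_def lessThan_atLeast0
      by (rule sum.atLeastLessThan_concat[symmetric]) (use mono3 in auto)
    then show ?case
      using Suc by simp
  qed
  obtain l where l: "(\<lambda>j. s (j ^ 3)) \<longlonglongrightarrow> l"
    using blocks unfolding s_cube summable_def sums_def by blast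
  have within: "\<bar>s n - s (j ^ 3)\<bar> \<le> 7 * K / real j"
    if j: "j ^ 3 \<le> n" "n < Suc j ^ 3" "0 < j" for j n :: nat
  proof -
    have "s n = s (j ^ 3) + (\<Sum>k = j ^ 3..<n. x k)"
      unfolding s_def lessThan_atLeast0
      by (rule sum.atLeastLessThan_concat[symmetric]) (use j in auto)
    then have "\<bar>s n - s (j ^ 3)\<bar> \<le> (\<Sum>k = j ^ 3..<n. \<bar>x k\<bar>)"
      by (simp add: sum_abs)
    also have "\<dots> \<le> (\<Sum>k = j ^ 3..<n. K / real j ^ 3)"
    proof (rule sum_mono)
      fix k assume "k \<in> {j ^ 3..<n}"
      then have "real j ^ 3 \<le> real (Suc k)"
        by (metis atLeastLessThan_iff le_SucI of_nat_le_iff of_nat_power)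
      then have "K / real (Suc k) \<le> K / real j ^ 3"
        using K0 j by (intro divide_left_mono) auto
      then show "\<bar>x k\<bar> \<le> K / real j ^ 3"
        using bound[of k] by linarith
    qed
    also have "\<dots> = real (n - j ^ 3) * (K / real j ^ 3)"
      by simp
    also have "\<dots> \<le> (7 * real j ^ 2) * (K / real j ^ 3)"
    proof (rule mult_right_mono)
      have "real n \<le> real (Suc j ^ 3)"
        using j by linarith
      moreover have "real j \<le> real j ^ 2" "1 \<le> real j ^ 2"
        using j by (auto simp: self_le_power)
      moreover have "real (Suc j ^ 3) = real j ^ 3 + 3 * real j ^ 2 + 3 * real j + 1"
        by (simp add: power3_eq_cube power2_eq_square algebra_simps)
      ultimately have "real n - real j ^ 3 \<le> 7 * real j ^ 2"
        by linarith
      then show "real (n - j ^ 3) \<le> 7 * real j ^ 2"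
        using j by (simp add: of_nat_diff)
      show "0 \<le> K / real j ^ 3"
        using K0 by simp
    qed
    also have "\<dots> = 7 * K / real j"
      using j by (simp add: power3_eq_cube power2_eq_square field_simps)
    finally show ?thesis .
  qed
  have "s \<longlonglongrightarrow> l"
  proof (rule LIMSEQ_I)
    fix e :: real assume e: "0 < e"
    have "(\<lambda>j. 7 * K / real j) \<longlonglongrightarrow> 0"
      by (rule lim_const_over_n)
    then have "eventually (\<lambda>j. 7 * K / real j < e / 2) sequentially"
      using e by (intro order_tendstoD) auto
    moreover have "eventually (\<lambda>j. dist (s (j ^ 3)) l < e / 2) sequentially"
      using l e by (intro tendstoD) auto
    ultimately have "eventually (\<lambda>j. 7 * K / real j < e / 2 \<and> dist (s (j ^ 3)) l < e / 2 \<and> 0 < j) sequentially"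
      using eventually_gt_at_top[of "0::nat"] by eventually_elim auto
    then obtain J where J: "\<And>j. J \<le> j \<Longrightarrow> 7 * K / real j < e / 2 \<and> dist (s (j ^ 3)) l < e / 2 \<and> 0 < j"
      unfolding eventually_sequentially by blast
    have "norm (s n - l) < e" if n: "J ^ 3 \<le> n" for n
    proof -
      \<comment> \<open>Index of the block containing \<open>n\<close>; the maximum exists because
        \<open>i \<le> i ^ 3 \<le> n\<close>.\<close>
      define j where "j = (GREATEST i. i ^ 3 \<le> n)"
      have bnd: "\<And>i. i ^ 3 \<le> n \<Longrightarrow> i \<le> n"
        by (metis le_trans self_le_power zero_less_numeral less_one not_le le0 One_nat_def Suc_leI gr0I)
      have 1: "j ^ 3 \<le> n"
        unfolding j_def by (rule GreatestI_nat[where P = "\<lambda>i. i ^ 3 \<le> n", OF n]) (use bnd in blast)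
      have 2: "J \<le> j"
        unfolding j_def by (rule Greatest_le_nat[where P = "\<lambda>i. i ^ 3 \<le> n", OF n]) (use bnd in blast)
      have 3: "n < Suc j ^ 3"
      proof (rule ccontr)
        assume "\<not> n < Suc j ^ 3"
        then have "Suc j \<le> j"
          unfolding j_def by (intro Greatest_le_nat[where P = "\<lambda>i. i ^ 3 \<le> n" and b = n])
            (use bnd in \<open>auto simp: not_less\<close>)
        then show False by simp
      qed
      show ?thesis
        using within[OF 1 3] J[OF 2] unfolding dist_real_def real_norm_def by linarith
    qed
    then show "\<exists>no. \<forall>n\<ge>no. norm (s n - l) < e"
      by blast
  qed
  then show ?thesis
    unfolding summable_def sums_def s_def by blast
qed

text \<open>Orthogonality removes the cross terms, so block j has second moment at most 7j^2
  (K/j^3)^2 = 7K^2/j^4. Its mean absolute value is thus of order 1/j^2, and the block sums are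
  absolutely summable almost surely. Cutting at cubes makes this order an integer power of
  j.\<close>

lemma (in prob_space) AE_summable_orthogonal:
  fixes X :: "nat \<Rightarrow> 'a \<Rightarrow> real"
  assumes meas [measurable]: "\<And>n. X n \<in> borel_measurable M"
    and bound: "\<And>n \<omega>. \<omega> \<in> space M \<Longrightarrow> \<bar>X n \<omega>\<bar> \<le> K / real (Suc n)"
    and orth: "\<And>m n. m < n \<Longrightarrow> expectation (\<lambda>\<omega>. X m \<omega> * X n \<omega>) = 0"
  shows "AE \<omega> in M. summable (\<lambda>n. X n \<omega>)"
proof -
  define S where "S j \<omega> = (\<Sum>k = j ^ 3..<Suc j ^ 3. X k \<omega>)" for j \<omega>
  have S_meas [measurable]: "S j \<in> borel_measurable M" for j
    unfolding S_def by measurable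
  obtain \<omega>0 where "\<omega>0 \<in> space M"
    using not_empty by blast
  then have K0: "0 \<le> K"
    using bound[of \<omega>0 0] by simp
  have XX_le: "\<bar>X m \<omega> * X n \<omega>\<bar> \<le> K / real (Suc m) * (K / real (Suc n))" if "\<omega> \<in> space M" for m n \<omega>
    unfolding abs_mult using bound[OF that] K0 by (intro mult_mono) auto
  have XX_int: "integrable M (\<lambda>\<omega>. X m \<omega> * X n \<omega>)" for m n
    by (rule integrable_const_bound[where B = "K / real (Suc m) * (K / real (Suc n))"])
      (use XX_le in auto)
  have orth': "expectation (\<lambda>\<omega>. X m \<omega> * X n \<omega>) = 0" if "m \<noteq> n" for m n
    using orth[of m n] orth[of n m] that by (cases m n rule: linorder_cases) (auto simp: mult.commute)
  have SS: "(S j \<omega>)\<^sup>2 = (\<Sum>m = j ^ 3..<Suc j ^ 3. \<Sum>n = j ^ 3..<Suc j ^ 3. X m \<omega> * X n \<omega>)" for j \<omega>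
    unfolding S_def power2_eq_square sum_product by simp
  have S2_int: "integrable M (\<lambda>\<omega>. (S j \<omega>)\<^sup>2)" for j
    unfolding SS by (intro Bochner_Integration.integrable_sum XX_int)
  have S2: "expectation (\<lambda>\<omega>. (S j \<omega>)\<^sup>2) \<le> 7 * K\<^sup>2 / real j ^ 4" if j: "0 < j" for j
  proof -
    have "expectation (\<lambda>\<omega>. (S j \<omega>)\<^sup>2) =
        (\<Sum>m = j ^ 3..<Suc j ^ 3. \<Sum>n = j ^ 3..<Suc j ^ 3. expectation (\<lambda>\<omega>. X m \<omega> * X n \<omega>))"
      unfolding SS by (simp add: XX_int)
    also have "\<dots> = (\<Sum>m = j ^ 3..<Suc j ^ 3. expectation (\<lambda>\<omega>. X m \<omega> * X m \<omega>))"
    proof (rule sum.cong)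
      fix m assume m: "m \<in> {j ^ 3..<Suc j ^ 3}"
      have "(\<Sum>n = j ^ 3..<Suc j ^ 3. expectation (\<lambda>\<omega>. X m \<omega> * X n \<omega>)) =
          (\<Sum>n\<in>{m}. expectation (\<lambda>\<omega>. X m \<omega> * X n \<omega>))"
        by (rule sum.mono_neutral_right) (use m orth' in auto)
      then show "(\<Sum>n = j ^ 3..<Suc j ^ 3. expectation (\<lambda>\<omega>. X m \<omega> * X n \<omega>)) =
          expectation (\<lambda>\<omega>. X m \<omega> * X m \<omega>)"
        by simp
    qed simp
    also have "\<dots> \<le> (\<Sum>m = j ^ 3..<Suc j ^ 3. (K / real j ^ 3)\<^sup>2)"
    proof (rule sum_mono)
      fix m assume m: "m \<in> {j ^ 3..<Suc j ^ 3}"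
      have "real j ^ 3 \<le> real (Suc m)"
        using m by (metis atLeastLessThan_iff le_SucI of_nat_le_iff of_nat_power)
      then have le: "K / real (Suc m) \<le> K / real j ^ 3"
        using K0 j by (intro divide_left_mono) auto
      have "X m \<omega> * X m \<omega> \<le> (K / real j ^ 3)\<^sup>2" if "\<omega> \<in> space M" for \<omega>
      proof -
        have "\<bar>X m \<omega>\<bar> \<le> K / real j ^ 3"
          using bound[OF that, of m] le by linarith
        then have "\<bar>X m \<omega>\<bar>\<^sup>2 \<le> (K / real j ^ 3)\<^sup>2"
          by (intro power_mono) auto
        then show ?thesis by (simp add: power2_eq_square)
      qed
      then have "expectation (\<lambda>\<omega>. X m \<omega> * X m \<omega>) \<le> expectation (\<lambda>_. (K / real j ^ 3)\<^sup>2)"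
        by (intro integral_mono XX_int) auto
      then show "expectation (\<lambda>\<omega>. X m \<omega> * X m \<omega>) \<le> (K / real j ^ 3)\<^sup>2"
        by (simp add: prob_space)
    qed
    also have "\<dots> = real (Suc j ^ 3 - j ^ 3) * (K / real j ^ 3)\<^sup>2"
      by simp
    also have "\<dots> \<le> (7 * real j ^ 2) * (K / real j ^ 3)\<^sup>2"
    proof (rule mult_right_mono)
      have "real j \<le> real j ^ 2" "1 \<le> real j ^ 2"
        using j by (auto simp: self_le_power)
      moreover have "real (Suc j ^ 3) = real j ^ 3 + 3 * real j ^ 2 + 3 * real j + 1"
        by (simp add: power3_eq_cube power2_eq_square algebra_simps)
      moreover have "j ^ 3 \<le> Suc j ^ 3"
        by (rule power_mono) auto
      ultimately have "real (Suc j ^ 3) - real (j ^ 3) \<le> 7 * real j ^ 2"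
        unfolding of_nat_power[of j 3] by linarith
      then show "real (Suc j ^ 3 - j ^ 3) \<le> 7 * real j ^ 2"
        using \<open>j ^ 3 \<le> Suc j ^ 3\<close> by (simp only: of_nat_diff)
    qed simp
    also have "\<dots> = 7 * K\<^sup>2 / real j ^ 4"
      using j by (simp add: field_simps power_def numeral_eq_Suc)
    finally show ?thesis .
  qed
  \<comment> \<open>The shift to \<open>Suc j\<close> skips block 0, since \<open>S2\<close> divides
    by \<open>j\<close>; one block does not affect summability.\<close>
  have S1: "(\<integral>\<^sup>+\<omega>. ennreal \<bar>S (Suc j) \<omega>\<bar> \<partial>M) \<le> ennreal ((7 * K\<^sup>2 + 1) / real (Suc j) ^ 2)" for j
  proof -
    let ?w = "real (Suc j) ^ 2"
    have w: "0 < ?w" by simp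
    \<comment> \<open>A weighted AM-GM inequality. The weight \<open>(j + 1) ^ 2\<close> balances
      the two terms: after taking expectations both are of order 1/j^2.\<close>
    have "\<bar>S (Suc j) \<omega>\<bar> \<le> ?w * (S (Suc j) \<omega>)\<^sup>2 + 1 / ?w" for \<omega>
    proof -
      have "0 \<le> (?w * \<bar>S (Suc j) \<omega>\<bar> - 1)\<^sup>2 + ?w * \<bar>S (Suc j) \<omega>\<bar>"
        using w by (intro add_nonneg_nonneg mult_nonneg_nonneg) auto
      also have "\<dots> = ?w * (?w * (S (Suc j) \<omega>)\<^sup>2 + 1 / ?w - \<bar>S (Suc j) \<omega>\<bar>)"
        using w by (simp add: power2_diff power_mult_distrib algebra_simps del: of_nat_Suc)
      finally show ?thesis
        using w by (simp add: zero_le_mult_iff del: of_nat_Suc)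
    qed
    then have "(\<integral>\<^sup>+\<omega>. ennreal \<bar>S (Suc j) \<omega>\<bar> \<partial>M) \<le> (\<integral>\<^sup>+\<omega>. ennreal (?w * (S (Suc j) \<omega>)\<^sup>2 + 1 / ?w) \<partial>M)"
      by (intro nn_integral_mono ennreal_leI)
    also have "\<dots> = ennreal (expectation (\<lambda>\<omega>. ?w * (S (Suc j) \<omega>)\<^sup>2 + 1 / ?w))"
      by (rule nn_integral_eq_integral) (auto intro!: S2_int add_nonneg_nonneg mult_nonneg_nonneg)
    also have "expectation (\<lambda>\<omega>. ?w * (S (Suc j) \<omega>)\<^sup>2 + 1 / ?w) = ?w * expectation (\<lambda>\<omega>. (S (Suc j) \<omega>)\<^sup>2) + 1 / ?w"
      by (simp add: S2_int prob_space)
    also have "\<dots> \<le> ?w * (7 * K\<^sup>2 / real (Suc j) ^ 4) + 1 / ?w"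
      by (intro add_right_mono mult_left_mono S2) auto
    also have "\<dots> = (7 * K\<^sup>2 + 1) / ?w"
      using w by (simp add: field_simps numeral_eq_Suc del: of_nat_Suc)
    finally show ?thesis
      by (simp add: ennreal_leI)
  qed
  have "(\<integral>\<^sup>+\<omega>. (\<Sum>j. ennreal \<bar>S (Suc j) \<omega>\<bar>) \<partial>M) = (\<Sum>j. \<integral>\<^sup>+\<omega>. ennreal \<bar>S (Suc j) \<omega>\<bar> \<partial>M)"
    by (rule nn_integral_suminf) measurable
  also have "\<dots> \<le> (\<Sum>j. ennreal ((7 * K\<^sup>2 + 1) / real (Suc j) ^ 2))"
    by (rule suminf_le[OF S1]) auto
  also have "\<dots> = ennreal (\<Sum>j. (7 * K\<^sup>2 + 1) / real (Suc j) ^ 2)"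
  proof (rule suminf_ennreal2)
    have "summable (\<lambda>j. 1 / real j ^ 2)"
      using inverse_power_summable[of 2, where 'a = real] by (simp add: divide_inverse)
    then have "summable (\<lambda>j. (7 * K\<^sup>2 + 1) * (1 / real (Suc j) ^ 2))"
      by (intro summable_mult) (subst summable_Suc_iff)
    then show "summable (\<lambda>j. (7 * K\<^sup>2 + 1) / real (Suc j) ^ 2)"
      by simp
  qed auto
  finally have "(\<integral>\<^sup>+\<omega>. (\<Sum>j. ennreal \<bar>S (Suc j) \<omega>\<bar>) \<partial>M) \<noteq> \<infinity>"
    by (auto simp: top_unique)
  then have "AE \<omega> in M. (\<Sum>j. ennreal \<bar>S (Suc j) \<omega>\<bar>) \<noteq> \<infinity>"
    by (intro nn_integral_PInf_AE) measurable
  then show ?thesis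
  proof (rule AE_mp, intro AE_I2 impI)
    fix \<omega> assume \<omega>: "\<omega> \<in> space M" and fin: "(\<Sum>j. ennreal \<bar>S (Suc j) \<omega>\<bar>) \<noteq> \<infinity>"
    have "summable (\<lambda>j. \<bar>S (Suc j) \<omega>\<bar>)"
      by (rule summable_suminf_not_top) (use fin in auto)
    then have "summable (\<lambda>j. S (Suc j) \<omega>)"
      by (rule summable_rabs_cancel)
    then have "summable (\<lambda>j. S j \<omega>)"
      by (subst (asm) summable_Suc_iff)
    then show "summable (\<lambda>n. X n \<omega>)"
      unfolding S_def using bound[OF \<omega>] by (rule summable_of_cubic_blocks[rotated])
  qed
qed

section \<open>Filtrations, and conditional expectations tested against bounded weights\<close>

locale filtered_prob_space = prob_space M for M :: "'a measure" +
  fixes F :: "nat \<Rightarrow> 'a measure"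
  assumes subalg: "subalgebra M (F n)"
    and subalg_Suc: "subalgebra (F (Suc n)) (F n)"
begin

lemma measurable_M: "f \<in> borel_measurable (F n) \<Longrightarrow> f \<in> borel_measurable M"
  by (rule measurable_from_subalg[OF subalg])

lemma measurable_Suc: "f \<in> borel_measurable (F n) \<Longrightarrow> f \<in> borel_measurable (F (Suc n))"
  by (rule measurable_from_subalg[OF subalg_Suc])

lemma measurable_mono:
  assumes "m \<le> n" and "f \<in> borel_measurable (F m)"
  shows "f \<in> borel_measurable (F n)"
  using assms by (induction rule: dec_induct) (auto intro: measurable_Suc)

lemma adapted_of_increments:
  fixes X Y :: "nat \<Rightarrow> 'a \<Rightarrow> real"
  assumes "\<And>\<omega>. X 0 \<omega> = c" and "\<And>n \<omega>. X (Suc n) \<omega> = X n \<omega> + Y n \<omega>"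
    and "\<And>n. Y n \<in> borel_measurable (F (Suc n))"
  shows "X n \<in> borel_measurable (F n)"
proof (induction n)
  case 0
  then show ?case
    using assms(1) by (simp add: fun_eq_iff[THEN iffD2, of "X 0" "\<lambda>_. c"])
next
  case (Suc n)
  then have "(\<lambda>\<omega>. X n \<omega> + Y n \<omega>) \<in> borel_measurable (F (Suc n))"
    by (intro borel_measurable_add measurable_Suc assms(3))
  moreover have "X (Suc n) = (\<lambda>\<omega>. X n \<omega> + Y n \<omega>)"
    using assms(2) by auto
  ultimately show ?case by simp
qed

text \<open>\<open>q n\<close> is a version of the conditional expectation of \<open>Z n\<close> given \<open>F n\<close>.\<close>

definition predicts :: "(nat \<Rightarrow> 'a \<Rightarrow> real) \<Rightarrow> (nat \<Rightarrow> 'a \<Rightarrow> real) \<Rightarrow> bool" where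
  "predicts q Z \<longleftrightarrow>
     (\<forall>n. Z n \<in> borel_measurable (F (Suc n)) \<and> q n \<in> borel_measurable (F n) \<and>
       (\<forall>\<omega>\<in>space M. Z n \<omega> \<in> {0..1} \<and> q n \<omega> \<in> {0..1}) \<and>
       (\<forall>W c. W \<in> borel_measurable (F n) \<longrightarrow> (\<forall>\<omega>\<in>space M. \<bar>W \<omega>\<bar> \<le> c) \<longrightarrow>
         expectation (\<lambda>\<omega>. W \<omega> * Z n \<omega>) = expectation (\<lambda>\<omega>. W \<omega> * q n \<omega>)))"

lemma predictsD:
  assumes "predicts q Z"
  shows "Z n \<in> borel_measurable (F (Suc n))" and "q n \<in> borel_measurable (F n)"
    and "\<omega> \<in> space M \<Longrightarrow> 0 \<le> Z n \<omega> \<and> Z n \<omega> \<le> 1"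
    and "\<omega> \<in> space M \<Longrightarrow> 0 \<le> q n \<omega> \<and> q n \<omega> \<le> 1"
    and "\<lbrakk>W \<in> borel_measurable (F n); \<And>\<omega>. \<omega> \<in> space M \<Longrightarrow> \<bar>W \<omega>\<bar> \<le> c\<rbrakk> \<Longrightarrow>
      expectation (\<lambda>\<omega>. W \<omega> * Z n \<omega>) = expectation (\<lambda>\<omega>. W \<omega> * q n \<omega>)"
  using assms unfolding predicts_def by fastforce+

lemma integrable_bounded_mult:
  fixes W Z :: "'a \<Rightarrow> real"
  assumes "W \<in> borel_measurable M" and "\<And>\<omega>. \<omega> \<in> space M \<Longrightarrow> \<bar>W \<omega>\<bar> \<le> c"
    and "Z \<in> borel_measurable M" and "\<And>\<omega>. \<omega> \<in> space M \<Longrightarrow> 0 \<le> Z \<omega> \<and> Z \<omega> \<le> 1"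
  shows "integrable M (\<lambda>\<omega>. W \<omega> * Z \<omega>)"
proof (rule integrable_const_bound[where B = c])
  show "AE \<omega> in M. norm (W \<omega> * Z \<omega>) \<le> c"
  proof (rule AE_I2)
    fix \<omega> assume \<omega>: "\<omega> \<in> space M"
    have "\<bar>W \<omega>\<bar> * \<bar>Z \<omega>\<bar> \<le> \<bar>W \<omega>\<bar>"
      using assms(4)[OF \<omega>] by (simp add: mult_left_le)
    then show "norm (W \<omega> * Z \<omega>) \<le> c"
      using assms(2)[OF \<omega>] by (simp add: abs_mult)
  qed
qed (use assms in measurable)

lemma predicts_integrable:
  assumes "predicts q Z" and "W \<in> borel_measurable (F n)"
    and "\<And>\<omega>. \<omega> \<in> space M \<Longrightarrow> \<bar>W \<omega>\<bar> \<le> c"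
  shows "integrable M (\<lambda>\<omega>. W \<omega> * Z n \<omega>)" and "integrable M (\<lambda>\<omega>. W \<omega> * q n \<omega>)"
  using assms predictsD[OF assms(1)] by (auto intro!: integrable_bounded_mult intro: measurable_M)

text \<open>The order hypotheses keep the differences in [0,1], as \<open>predicts\<close> demands.
  The lemma serves \<open>1 - B\<close> for the reversed urn and \<open>D v - D v * D w\<close>, the
  indicator of a discordant pair.\<close>

lemma predicts_diff:
  assumes "predicts q Z" and "predicts q' Z'"
    and "\<And>n \<omega>. \<omega> \<in> space M \<Longrightarrow> Z' n \<omega> \<le> Z n \<omega>"
    and "\<And>n \<omega>. \<omega> \<in> space M \<Longrightarrow> q' n \<omega> \<le> q n \<omega>"
  shows "predicts (\<lambda>n \<omega>. q n \<omega> - q' n \<omega>) (\<lambda>n \<omega>. Z n \<omega> - Z' n \<omega>)"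
  unfolding predicts_def
proof (intro allI conjI impI ballI)
  note [measurable] = predictsD(1,2)[OF assms(1)] predictsD(1,2)[OF assms(2)]
  fix n
  show "(\<lambda>\<omega>. Z n \<omega> - Z' n \<omega>) \<in> borel_measurable (F (Suc n))"
    and "(\<lambda>\<omega>. q n \<omega> - q' n \<omega>) \<in> borel_measurable (F n)"
    by measurable
  show "Z n \<omega> - Z' n \<omega> \<in> {0..1}" and "q n \<omega> - q' n \<omega> \<in> {0..1}" if "\<omega> \<in> space M" for \<omega>
    using predictsD(3,4)[OF assms(1) that, of n] predictsD(3,4)[OF assms(2) that, of n]
      assms(3,4)[OF that, of n] by auto
  fix W :: "'a \<Rightarrow> real" and c
  assume W: "W \<in> borel_measurable (F n)" and "\<forall>\<omega>\<in>space M. \<bar>W \<omega>\<bar> \<le> c"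
  then have c: "\<And>\<omega>. \<omega> \<in> space M \<Longrightarrow> \<bar>W \<omega>\<bar> \<le> c"
    by blast
  show "expectation (\<lambda>\<omega>. W \<omega> * (Z n \<omega> - Z' n \<omega>)) = expectation (\<lambda>\<omega>. W \<omega> * (q n \<omega> - q' n \<omega>))"
    unfolding right_diff_distrib
    using predictsD(5)[OF assms(1) W c] predictsD(5)[OF assms(2) W c]
      predicts_integrable[OF assms(1) W c] predicts_integrable[OF assms(2) W c]
    by simp
qed

lemma predicts_cong:
  assumes "predicts q Z"
    and q: "\<And>n \<omega>. \<omega> \<in> space M \<Longrightarrow> q n \<omega> = q' n \<omega>"
    and Z: "\<And>n \<omega>. \<omega> \<in> space M \<Longrightarrow> Z n \<omega> = Z' n \<omega>"
  shows "predicts q' Z'"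
proof -
  have "space (F n) = space M" for n
    using subalg by (simp add: subalgebra_def)
  then have "Z n \<in> borel_measurable (F (Suc n)) \<longleftrightarrow> Z' n \<in> borel_measurable (F (Suc n))"
    and "q n \<in> borel_measurable (F n) \<longleftrightarrow> q' n \<in> borel_measurable (F n)" for n
    using q Z by (auto intro!: measurable_cong)
  moreover have "expectation (\<lambda>\<omega>. W \<omega> * Z n \<omega>) = expectation (\<lambda>\<omega>. W \<omega> * Z' n \<omega>)"
    and "expectation (\<lambda>\<omega>. W \<omega> * q n \<omega>) = expectation (\<lambda>\<omega>. W \<omega> * q' n \<omega>)" for W n
    using q Z by (auto intro!: Bochner_Integration.integral_cong)
  ultimately show ?thesis
    using assms unfolding predicts_def by simp
qed

lemma predicts_one: "predicts (\<lambda>_ _. 1) (\<lambda>_ _. 1)"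
  unfolding predicts_def by simp

text \<open>The terms are martingale differences: weights known at time \<open>n\<close> times a
  centred variable revealed at time \<open>n + 1\<close>. Hence they are orthogonal.\<close>

lemma AE_summable_innovations:
  assumes pred: "predicts q Z"
    and W: "\<And>n. W n \<in> borel_measurable (F n)"
    and bound: "\<And>n \<omega>. \<omega> \<in> space M \<Longrightarrow> \<bar>W n \<omega>\<bar> \<le> K / real (Suc n)"
  shows "AE \<omega> in M. summable (\<lambda>n. W n \<omega> * (Z n \<omega> - q n \<omega>))"
proof (rule AE_summable_orthogonal[where K = K])
  note Z = predictsD(1)[OF pred] and q = predictsD(2)[OF pred]
  have meas: "(\<lambda>\<omega>. W n \<omega> * (Z n \<omega> - q n \<omega>)) \<in> borel_measurable (F (Suc n))" for n
    using Z[of n] measurable_Suc[OF q[of n]] measurable_Suc[OF W[of n]] by measurable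
  then show "(\<lambda>\<omega>. W n \<omega> * (Z n \<omega> - q n \<omega>)) \<in> borel_measurable M" for n
    by (rule measurable_M)
  show bd: "\<bar>W n \<omega> * (Z n \<omega> - q n \<omega>)\<bar> \<le> K / real (Suc n)" if "\<omega> \<in> space M" for n \<omega>
  proof -
    have "\<bar>Z n \<omega> - q n \<omega>\<bar> \<le> 1"
      using predictsD(3,4)[OF pred that, of n] by (auto simp: abs_le_iff)
    then have "\<bar>W n \<omega>\<bar> * \<bar>Z n \<omega> - q n \<omega>\<bar> \<le> \<bar>W n \<omega>\<bar>"
      by (simp add: mult_left_le)
    then show ?thesis
      using bound[OF that, of n] by (simp add: abs_mult)
  qed
  fix m n :: nat assume "m < n"
  \<comment> \<open>All of the product except the innovation at time \<open>n\<close>. It is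
    \<open>F n\<close>-measurable because \<open>m + 1 \<le> n\<close>, so it is an admissible
    weight for \<open>predicts\<close>.\<close>
  define V where "V \<omega> = W m \<omega> * (Z m \<omega> - q m \<omega>) * W n \<omega>" for \<omega>
  have V: "V \<in> borel_measurable (F n)"
    unfolding V_def using measurable_mono[OF Suc_leI[OF \<open>m < n\<close>] meas[of m]] W[of n]
    by (rule borel_measurable_times)
  have Vb: "\<bar>V \<omega>\<bar> \<le> K / real (Suc m) * (K / real (Suc n))" if "\<omega> \<in> space M" for \<omega>
    unfolding V_def abs_mult[of _ "W n \<omega>"]
    using bd[OF that, of m] bound[OF that, of n] by (intro mult_mono) auto
  have "expectation (\<lambda>\<omega>. V \<omega> * Z n \<omega> - V \<omega> * q n \<omega>) = 0"
    using predictsD(5)[OF pred V Vb] predicts_integrable[OF pred V Vb] by simp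
  then show "expectation (\<lambda>\<omega>. W m \<omega> * (Z m \<omega> - q m \<omega>) * (W n \<omega> * (Z n \<omega> - q n \<omega>))) = 0"
    by (simp add: V_def algebra_simps)
qed

text \<open>
  A conditional Borel--Cantelli lemma: \<open>(Z n - q n) / (n + 1)\<close> is almost surely summable, so if
  \<open>Z n\<close> were eventually 0, then \<open>q n / (n + 1)\<close> would be summable.
\<close>

lemma AE_frequently_of_predicts:
  assumes pred: "predicts q Z"
    and Z01: "\<And>n \<omega>. \<omega> \<in> space M \<Longrightarrow> Z n \<omega> \<in> {0, 1}"
    and lim: "AE \<omega> in M. \<exists>p>0. (\<lambda>n. q n \<omega>) \<longlonglongrightarrow> p"
  shows "AE \<omega> in M. \<exists>\<^sub>F n in sequentially. Z n \<omega> = 1"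
proof -
  have "AE \<omega> in M. summable (\<lambda>n. 1 / real (Suc n) * (Z n \<omega> - q n \<omega>))"
    by (rule AE_summable_innovations[OF pred, where K = 1]) auto
  with lim AE_space show ?thesis
  proof eventually_elim
    case (elim \<omega>)
    then obtain p where p: "0 < p" "(\<lambda>n. q n \<omega>) \<longlonglongrightarrow> p"
      by blast
    show ?case
    proof (rule ccontr)
      assume "\<not> ?case"
      then have "\<forall>\<^sub>F n in sequentially. Z n \<omega> \<noteq> 1"
        by (simp add: not_frequently)
      moreover have "\<forall>\<^sub>F n in sequentially. p / 2 < q n \<omega>"
        using p by (intro order_tendstoD) auto
      \<comment> \<open>Where \<open>Z n = 0\<close> and \<open>q n > p / 2\<close>, the negated
        innovation exceeds \<open>p / 2\<close> times 1/(n+1), so a convergent series would dominate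
        the harmonic one.\<close>
      ultimately have "\<forall>\<^sub>F n in sequentially.
          norm (1 / real (Suc n)) \<le> 2 / p * - (1 / real (Suc n) * (Z n \<omega> - q n \<omega>))"
      proof eventually_elim
        case 1: (elim n)
        then have "Z n \<omega> = 0"
          using Z01[OF elim(2), of n] by auto
        moreover have "1 / real (Suc n) * 1 \<le> 1 / real (Suc n) * (2 / p * q n \<omega>)"
          using 1 p(1) by (intro mult_left_mono) (auto simp: field_simps)
        ultimately show ?case
          by (simp add: ac_simps)
      qed
      moreover have "summable (\<lambda>n. 2 / p * - (1 / real (Suc n) * (Z n \<omega> - q n \<omega>)))"
        by (intro summable_mult summable_minus elim)
      ultimately have "summable (\<lambda>n. 1 / real (Suc n))"
        by (rule summable_comparison_test_ev)
      then have "summable (\<lambda>n. 1 / real n)"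
        by (subst (asm) summable_Suc_iff)
      then show False
        using not_summable_harmonic[where 'a = real] by (simp add: divide_inverse)
    qed
  qed
qed

end

section \<open>A single urn with random, bounded additions\<close>

text \<open>\<open>L\<close> and \<open>T\<close> include the initial weights \<open>\<eta>\<close>
  and \<open>2 * \<eta>\<close>, so that \<open>L / T\<close> is the drawing probability itself. The
  addition \<open>I n\<close> is known before the draw \<open>B n\<close>, which is revealed only at
  time \<open>n + 1\<close>.\<close>

locale urn = filtered_prob_space M F for M :: "'a measure" and F +
  fixes \<eta> K :: real and I B L T :: "nat \<Rightarrow> 'a \<Rightarrow> real"
  assumes \<eta>_pos: "0 < \<eta>"
    and L_0: "L 0 \<omega> = \<eta>" and L_Suc: "L (Suc n) \<omega> = L n \<omega> + I n \<omega> * B n \<omega>"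
    and T_0: "T 0 \<omega> = 2 * \<eta>" and T_Suc: "T (Suc n) \<omega> = T n \<omega> + I n \<omega>"
    and I_measurable: "I n \<in> borel_measurable (F n)"
    and I_bounds: "\<omega> \<in> space M \<Longrightarrow> 1 \<le> I n \<omega> \<and> I n \<omega> \<le> K"
    and B_01: "\<omega> \<in> space M \<Longrightarrow> B n \<omega> \<in> {0, 1}"
    and predicts_B: "predicts (\<lambda>n \<omega>. L n \<omega> / T n \<omega>) B"
begin

lemma T_measurable: "T n \<in> borel_measurable (F n)"
  by (rule adapted_of_increments[OF T_0 T_Suc]) (rule measurable_Suc[OF I_measurable])

lemma L_measurable: "L n \<in> borel_measurable (F n)"
proof (rule adapted_of_increments[OF L_0 L_Suc])
  show "(\<lambda>\<omega>. I n \<omega> * B n \<omega>) \<in> borel_measurable (F (Suc n))" for n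
    using measurable_Suc[OF I_measurable[of n]] predictsD(1)[OF predicts_B, of n] by measurable
qed

lemma T_lower:
  assumes "\<omega> \<in> space M"
  shows "real n + 2 * \<eta> \<le> T n \<omega>"
proof (induction n)
  case (Suc n)
  then show ?case
    using I_bounds[OF assms, of n] by (simp add: T_Suc)
qed (simp add: T_0)

lemma L_bounds:
  assumes "\<omega> \<in> space M"
  shows "\<eta> \<le> L n \<omega> \<and> L n \<omega> \<le> T n \<omega> - \<eta>"
proof (induction n)
  case (Suc n)
  then show ?case
    using I_bounds[OF assms, of n] B_01[OF assms, of n] by (auto simp: T_Suc L_Suc)
qed (simp add: T_0 L_0)

text \<open>The increment of \<open>L / T\<close> is \<open>I n / T (Suc n)\<close> times the
  innovation \<open>B n - L n / T n\<close>. The factor is known at time \<open>n\<close>, since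
  \<open>T (Suc n) = T n + I n\<close>, and is at most K/(n+1).\<close>

lemma AE_fraction_convergent: "AE \<omega> in M. convergent (\<lambda>n. L n \<omega> / T n \<omega>)"
proof -
  have "AE \<omega> in M. summable (\<lambda>n. I n \<omega> / T (Suc n) \<omega> * (B n \<omega> - L n \<omega> / T n \<omega>))"
  proof (rule AE_summable_innovations[OF predicts_B])
    show "(\<lambda>\<omega>. I n \<omega> / T (Suc n) \<omega>) \<in> borel_measurable (F n)" for n
      unfolding T_Suc using T_measurable[of n] I_measurable[of n] by measurable
    show "\<bar>I n \<omega> / T (Suc n) \<omega>\<bar> \<le> K / real (Suc n)" if "\<omega> \<in> space M" for n \<omega>
      using T_lower[OF that, of "Suc n"] I_bounds[OF that, of n] \<eta>_pos
      by (auto simp: abs_divide intro!: frac_le)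
  qed
  with AE_space show ?thesis
  proof eventually_elim
    case (elim \<omega>)
    have "I n \<omega> / T (Suc n) \<omega> * (B n \<omega> - L n \<omega> / T n \<omega>) = L (Suc n) \<omega> / T (Suc n) \<omega> - L n \<omega> / T n \<omega>" for n
    proof -
      have "0 < T n \<omega>" "0 < T n \<omega> + I n \<omega>"
        using T_lower[OF elim(1), of n] I_bounds[OF elim(1), of n] \<eta>_pos by auto
      then show ?thesis
        unfolding L_Suc T_Suc by (simp add: field_simps)
    qed
    with elim(2) have "summable (\<lambda>n. L (Suc n) \<omega> / T (Suc n) \<omega> - L n \<omega> / T n \<omega>)"
      by simp
    then have "convergent (\<lambda>n. L n \<omega> / T n \<omega> - L 0 \<omega> / T 0 \<omega>)"
      unfolding summable_iff_convergent sum_lessThan_telescope[of "\<lambda>n. L n \<omega> / T n \<omega>"] .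
    then show ?case
      by (simp add: convergent_diff_const_right_iff)
  qed
qed

text \<open>
  The process \<open>ln (T n / L n) + K / L n\<close> is a supermartingale: the second summand compensates
  for the second-order terms in the drift of the first.
\<close>

definition potential :: "nat \<Rightarrow> 'a \<Rightarrow> real" where
  "potential n \<omega> = ln (T n \<omega> / L n \<omega>) + K / L n \<omega>"

text \<open>\<open>U\<close> is the growth of \<open>ln T\<close>, and \<open>V\<close> is the drop
  of the potential caused by a left draw. Since \<open>V \<ge> I / L\<close>, the mean drop
  \<open>V * (L / T)\<close> is at least \<open>I / T\<close>, which is at least \<open>U\<close>.
  The bound \<open>ln 2 + K / \<eta>\<close> is the initial value. All quantities tested are bounded
  because \<open>L \<ge> \<eta>\<close>.\<close>

lemma potential_integral:
  "integrable M (potential n) \<and> expectation (potential n) \<le> ln 2 + K / \<eta>"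
proof (induction n)
  case 0
  have "potential 0 = (\<lambda>_. ln 2 + K / \<eta>)"
    using \<eta>_pos by (auto simp: potential_def L_0 T_0)
  then show ?case by (simp add: prob_space)
next
  case (Suc n)
  define U where "U \<omega> = ln (T n \<omega> + I n \<omega>) - ln (T n \<omega>)" for \<omega>
  define V where "V \<omega> = ln (L n \<omega> + I n \<omega>) - ln (L n \<omega>) + (K / L n \<omega> - K / (L n \<omega> + I n \<omega>))" for \<omega>
  note [measurable] = T_measurable[of n] L_measurable[of n] I_measurable[of n]
  have U: "U \<in> borel_measurable (F n)" and V: "V \<in> borel_measurable (F n)"
    unfolding U_def V_def by measurable
  have facts: "0 < T n \<omega> \<and> 0 < L n \<omega> \<and> \<eta> \<le> L n \<omega> \<and> 2 * \<eta> \<le> T n \<omega> \<and> 1 \<le> I n \<omega> \<and> I n \<omega> \<le> K"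
    if "\<omega> \<in> space M" for \<omega>
    using T_lower[OF that, of n] L_bounds[OF that, of n] I_bounds[OF that, of n] \<eta>_pos by auto
  have U_bound: "0 \<le> U \<omega> \<and> U \<omega> \<le> I n \<omega> / T n \<omega> \<and> \<bar>U \<omega>\<bar> \<le> K / (2 * \<eta>)" if \<omega>: "\<omega> \<in> space M" for \<omega>
  proof -
    have "0 \<le> U \<omega>" "U \<omega> \<le> I n \<omega> / T n \<omega>"
      unfolding U_def using facts[OF \<omega>] ln_add_ge[of "T n \<omega>" "I n \<omega>"] by auto
    moreover have "I n \<omega> / T n \<omega> \<le> K / (2 * \<eta>)"
      using facts[OF \<omega>] \<eta>_pos by (intro frac_le) auto
    ultimately show ?thesis by auto
  qed
  have V_bound: "I n \<omega> / L n \<omega> \<le> V \<omega> \<and> \<bar>V \<omega>\<bar> \<le> 2 * K / \<eta>" if \<omega>: "\<omega> \<in> space M" for \<omega>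
  proof -
    note f = facts[OF \<omega>]
    have "K / L n \<omega> - K / (L n \<omega> + I n \<omega>) = K * I n \<omega> / (L n \<omega> * (L n \<omega> + I n \<omega>))"
      using f by (simp add: field_simps)
    \<comment> \<open>Here \<open>I \<le> K\<close> enters: the drop of \<open>K / L\<close> covers
      the gap \<open>I / L - I / (L + I)\<close> left by the logarithm.\<close>
    also have "\<dots> \<ge> I n \<omega> * I n \<omega> / (L n \<omega> * (L n \<omega> + I n \<omega>))"
      using f by (intro divide_right_mono mult_right_mono) auto
    finally have "I n \<omega> / (L n \<omega> + I n \<omega>) + I n \<omega> * I n \<omega> / (L n \<omega> * (L n \<omega> + I n \<omega>)) \<le> V \<omega>"
      unfolding V_def using ln_add_ge(1)[of "L n \<omega>" "I n \<omega>"] f by linarith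
    moreover have "I n \<omega> / (L n \<omega> + I n \<omega>) + I n \<omega> * I n \<omega> / (L n \<omega> * (L n \<omega> + I n \<omega>)) = I n \<omega> / L n \<omega>"
    proof -
      have "L n \<omega> + I n \<omega> \<noteq> 0"
        using f by linarith
      then show ?thesis
        using f by (simp add: divide_simps) (simp add: algebra_simps)
    qed
    moreover have "0 \<le> I n \<omega> / L n \<omega>" "I n \<omega> / L n \<omega> \<le> K / \<eta>" "K / L n \<omega> \<le> K / \<eta>" "0 \<le> K / (L n \<omega> + I n \<omega>)"
      using f \<eta>_pos by (auto intro!: frac_le divide_nonneg_nonneg)
    moreover have "V \<omega> \<le> I n \<omega> / L n \<omega> + (K / L n \<omega> - K / (L n \<omega> + I n \<omega>))"
      unfolding V_def using ln_add_ge(2)[of "L n \<omega>" "I n \<omega>"] f by linarith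
    ultimately show ?thesis by auto
  qed
  have step: "potential (Suc n) \<omega> = potential n \<omega> + U \<omega> - V \<omega> * B n \<omega>" if \<omega>: "\<omega> \<in> space M" for \<omega>
    using B_01[OF \<omega>, of n] facts[OF \<omega>]
    by (auto simp: potential_def U_def V_def T_Suc L_Suc ln_div add_pos_pos)
  have VU: "U \<omega> \<le> V \<omega> * (L n \<omega> / T n \<omega>)" if \<omega>: "\<omega> \<in> space M" for \<omega>
  proof -
    have "I n \<omega> / L n \<omega> * (L n \<omega> / T n \<omega>) \<le> V \<omega> * (L n \<omega> / T n \<omega>)"
      using V_bound[OF \<omega>] facts[OF \<omega>] by (intro mult_right_mono) auto
    then show ?thesis
      using U_bound[OF \<omega>] facts[OF \<omega>] by simp
  qed
  have U_int: "integrable M U"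
    by (rule integrable_const_bound[where B = "K / (2 * \<eta>)"]) (use U_bound measurable_M[OF U] in \<open>fastforce intro!: AE_I2\<close>)+
  have V_le: "\<And>\<omega>. \<omega> \<in> space M \<Longrightarrow> \<bar>V \<omega>\<bar> \<le> 2 * K / \<eta>"
    using V_bound by blast
  note VB_int = predicts_integrable[OF predicts_B V V_le]
  have int': "integrable M (\<lambda>\<omega>. potential n \<omega> + U \<omega> - V \<omega> * B n \<omega>)"
    using Suc U_int VB_int by auto
  have "expectation (potential (Suc n)) = expectation (\<lambda>\<omega>. potential n \<omega> + U \<omega> - V \<omega> * B n \<omega>)"
    using step by (intro Bochner_Integration.integral_cong) auto
  also have "\<dots> = expectation (potential n) + expectation U - expectation (\<lambda>\<omega>. V \<omega> * (L n \<omega> / T n \<omega>))"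
    using predictsD(5)[OF predicts_B V V_le] Suc U_int VB_int by simp
  also have "\<dots> \<le> expectation (potential n)"
    using integral_mono[OF U_int VB_int(2)] VU by simp
  finally have "expectation (potential (Suc n)) \<le> ln 2 + K / \<eta>"
    using Suc by simp
  moreover have "integrable M (potential (Suc n)) \<longleftrightarrow> integrable M (\<lambda>\<omega>. potential n \<omega> + U \<omega> - V \<omega> * B n \<omega>)"
    by (rule Bochner_Integration.integrable_cong) (simp_all add: step)
  ultimately show ?case
    using int' by simp
qed

text \<open>By Fatou the liminf of the potential is finite almost surely. If it lies below
  \<open>r\<close>, then \<open>L / T < exp (- r)\<close> cannot hold eventually, because this would
  push the potential above \<open>r\<close>; so the limit is at least
  \<open>exp (- r)\<close>.\<close>

lemma AE_fraction_limit_pos: "AE \<omega> in M. \<exists>p>0. (\<lambda>n. L n \<omega> / T n \<omega>) \<longlonglongrightarrow> p"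
proof -
  have pos: "0 \<le> ln (T n \<omega> / L n \<omega>) \<and> 0 \<le> K / L n \<omega>" if "\<omega> \<in> space M" for n \<omega>
    using L_bounds[OF that, of n] \<eta>_pos I_bounds[OF that, of n] by (auto intro!: ln_ge_zero)
  then have potential_nonneg: "0 \<le> potential n \<omega>" if "\<omega> \<in> space M" for n \<omega>
    using that by (simp add: potential_def)
  note [measurable] = measurable_M[OF T_measurable] measurable_M[OF L_measurable]
  have meas [measurable]: "potential n \<in> borel_measurable M" for n
    unfolding potential_def[abs_def] by measurable
  have "(\<integral>\<^sup>+\<omega>. liminf (\<lambda>n. ennreal (potential n \<omega>)) \<partial>M) \<le> liminf (\<lambda>n. \<integral>\<^sup>+\<omega>. ennreal (potential n \<omega>) \<partial>M)"
    by (rule nn_integral_liminf) measurable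
  also have "\<dots> \<le> liminf (\<lambda>_. ennreal (ln 2 + K / \<eta>))"
  proof (intro Liminf_mono always_eventually allI)
    fix n
    have "(\<integral>\<^sup>+\<omega>. ennreal (potential n \<omega>) \<partial>M) = ennreal (expectation (potential n))"
      by (rule nn_integral_eq_integral) (use potential_integral potential_nonneg in auto)
    also have "\<dots> \<le> ennreal (ln 2 + K / \<eta>)"
      using potential_integral[of n] by (intro ennreal_leI) auto
    finally show "(\<integral>\<^sup>+\<omega>. ennreal (potential n \<omega>) \<partial>M) \<le> ennreal (ln 2 + K / \<eta>)" .
  qed
  also have "\<dots> = ennreal (ln 2 + K / \<eta>)"
    by (rule Liminf_const) simp
  finally have "(\<integral>\<^sup>+\<omega>. liminf (\<lambda>n. ennreal (potential n \<omega>)) \<partial>M) \<noteq> \<infinity>"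
    by (auto simp: top_unique)
  then have "AE \<omega> in M. liminf (\<lambda>n. ennreal (potential n \<omega>)) \<noteq> \<infinity>"
    by (intro nn_integral_PInf_AE) measurable
  with AE_space AE_fraction_convergent show ?thesis
  proof eventually_elim
    case (elim \<omega>)
    obtain p where p: "(\<lambda>n. L n \<omega> / T n \<omega>) \<longlonglongrightarrow> p"
      using elim(2) by (auto simp: convergent_def)
    obtain r where r: "liminf (\<lambda>n. ennreal (potential n \<omega>)) < ennreal r" "0 \<le> r"
      using elim(3) by (metis ennreal_cases ennreal_less_iff infinity_ennreal_def lt_ex
          less_add_one add_increasing zero_le_one less_imp_le)
    have "exp (- r) \<le> p"
    proof (rule ccontr)
      assume "\<not> exp (- r) \<le> p"
      then have "\<forall>\<^sub>F n in sequentially. L n \<omega> / T n \<omega> < exp (- r)"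
        using p by (intro order_tendstoD) auto
      then have "\<forall>\<^sub>F n in sequentially. ennreal r \<le> ennreal (potential n \<omega>)"
      proof eventually_elim
        case le: (elim n)
        have TL: "0 < T n \<omega>" "0 < L n \<omega>"
          using T_lower[OF elim(1), of n] L_bounds[OF elim(1), of n] \<eta>_pos by auto
        then have "ln (L n \<omega> / T n \<omega>) < - r"
          using le by (metis divide_pos_pos exp_gt_zero ln_exp ln_less_cancel_iff)
        then have "r \<le> ln (T n \<omega> / L n \<omega>)"
          using TL by (simp add: ln_div)
        then show ?case
          using pos[OF elim(1), of n] by (intro ennreal_leI) (simp add: potential_def)
      qed
      then have "ennreal r \<le> liminf (\<lambda>n. ennreal (potential n \<omega>))"
        by (rule Liminf_bounded)
      then show False
        using r by simp
    qed
    then show ?case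
      using p by (intro exI[of _ p]) (auto intro: less_le_trans[OF exp_gt_zero])
  qed
qed

text \<open>\<open>T - L\<close> also starts at \<open>\<eta>\<close> and receives
  \<open>I * (1 - B)\<close>, so exchanging left and right gives an urn with the same constants, and
  excluding the limit 0 there excludes the limit 1 here.\<close>

lemma reversed: "urn M F \<eta> K I (\<lambda>n \<omega>. 1 - B n \<omega>) (\<lambda>n \<omega>. T n \<omega> - L n \<omega>) T"
proof
  have "predicts (\<lambda>n \<omega>. 1 - L n \<omega> / T n \<omega>) (\<lambda>n \<omega>. 1 - B n \<omega>)"
    using predictsD(3,4)[OF predicts_B] by (intro predicts_diff[OF predicts_one predicts_B]) auto
  then show "predicts (\<lambda>n \<omega>. (T n \<omega> - L n \<omega>) / T n \<omega>) (\<lambda>n \<omega>. 1 - B n \<omega>)"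
  proof (rule predicts_cong)
    fix n \<omega> assume "\<omega> \<in> space M"
    then have "T n \<omega> \<noteq> 0"
      using T_lower[of \<omega> n] \<eta>_pos by auto
    then show "1 - L n \<omega> / T n \<omega> = (T n \<omega> - L n \<omega>) / T n \<omega>"
      by (simp add: diff_divide_distrib)
  qed simp
qed (use \<eta>_pos L_0 L_Suc T_0 T_Suc I_measurable I_bounds B_01 in \<open>fastforce simp: algebra_simps\<close>)+

lemma AE_fraction_limit_interior: "AE \<omega> in M. \<exists>p. 0 < p \<and> p < 1 \<and> (\<lambda>n. L n \<omega> / T n \<omega>) \<longlonglongrightarrow> p"
  using AE_space AE_fraction_limit_pos urn.AE_fraction_limit_pos[OF reversed]
proof eventually_elim
  case (elim \<omega>)
  then obtain p p' where p: "0 < p" "(\<lambda>n. L n \<omega> / T n \<omega>) \<longlonglongrightarrow> p"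
      and p': "0 < p'" "(\<lambda>n. (T n \<omega> - L n \<omega>) / T n \<omega>) \<longlonglongrightarrow> p'"
    by blast
  have "L n \<omega> / T n \<omega> + (T n \<omega> - L n \<omega>) / T n \<omega> = 1" for n
    using T_lower[OF elim(1), of n] \<eta>_pos by (simp add: add_divide_distrib[symmetric])
  then have "(\<lambda>_. 1) \<longlonglongrightarrow> p + p'"
    using tendsto_add[OF p(2) p'(2)] by simp
  then have "p + p' = 1"
    by (simp add: LIMSEQ_const_iff)
  then show ?case
    using p p' by (intro exI[of _ p]) auto
qed

end

section \<open>The network: adaptedness, bounds and conditional laws\<close>

context erosion_network
begin

lemma measurable_history:
  assumes "v \<in> nodes" and "1 \<le> k" and "k \<le> n"
  shows "D v k \<in> borel_measurable (history M D n)"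
proof (rule measurableI)
  have sp: "space (history M D n) = space M"
    using subalgebra_history[of n] by (simp add: subalgebra_def)
  fix A :: "real set" assume "A \<in> sets borel"
  then have "D v k -` A \<inter> space M \<in> {D u k -` B \<inter> space M | u k B. u \<in> nodes \<and> 1 \<le> k \<and> k \<le> n \<and> B \<in> sets borel}"
    using assms by blast
  then show "D v k -` A \<inter> space (history M D n) \<in> sets (history M D n)"
    unfolding sp unfolding history_def by (intro in_measure_of) auto
qed simp

lemma subalgebra_history_Suc: "subalgebra (history M D (Suc n)) (history M D n)"
proof -
  have "{D u k -` B \<inter> space M | u k B. u \<in> nodes \<and> 1 \<le> k \<and> k \<le> n \<and> B \<in> sets borel}
      \<subseteq> {D u k -` B \<inter> space M | u k B. u \<in> nodes \<and> 1 \<le> k \<and> k \<le> Suc n \<and> B \<in> sets borel}"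
    using le_SucI by blast
  from sigma_sets_mono'[OF this, of "space M"] show ?thesis
    using subalgebra_history[of n] subalgebra_history[of "Suc n"]
    unfolding subalgebra_def history_def by (subst (1 2) sets_measure_of) auto
qed

sublocale filtered_prob_space M "history M D"
  by unfold_locales (rule subalgebra_history subalgebra_history_Suc)+

lemma D_measurable_Suc: "v \<in> nodes \<Longrightarrow> D v (Suc n) \<in> borel_measurable (history M D (Suc n))"
  by (rule measurable_history) auto

lemma parents_in_nodes:
  assumes "v \<in> nodes" and "depth v \<noteq> 1"
  shows "left_parent v \<in> nodes" and "right_parent v \<in> nodes"
  using assms by (auto simp: nodes_def depth_def left_parent_def right_parent_def)

lemma inflow_measurable: "v \<in> nodes \<Longrightarrow> inflow D v n \<in> borel_measurable (history M D n)"
proof (induction n arbitrary: v)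
  case 0
  then show ?case by (simp add: inflow.simps(1)[abs_def])
next
  case (Suc n)
  show ?case
  proof (cases "depth v = 1")
    case True
    then show ?thesis by (simp add: inflow.simps(2)[abs_def])
  next
    case False
    note w = parents_in_nodes[OF Suc.prems False]
    note [measurable] = measurable_Suc[OF Suc.IH[OF w(1)]] measurable_Suc[OF Suc.IH[OF w(2)]]
      D_measurable_Suc[OF w(1), of n] D_measurable_Suc[OF w(2), of n]
    show ?thesis
      using False unfolding inflow.simps(2)[abs_def] by measurable
  qed
qed

text \<open>The numbers c(d) = 2^d - 1 satisfy c(d+1) = 2c(d) + 1: at worst both parents send all
  their flow to \<open>v\<close>, and one unit is added. The bound is uniform in time, as the urn
  requires.\<close>

lemma inflow_bounds:
  assumes "\<omega> \<in> space M"
  shows "v \<in> nodes \<Longrightarrow> 1 \<le> inflow D v n \<omega> \<and> inflow D v n \<omega> \<le> 2 ^ nat (depth v) - 1"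
proof (induction n arbitrary: v)
  case base: 0
  then have "1 \<le> nat (depth v)"
    by (auto simp: nodes_def depth_def)
  then have "(2::real) ^ 1 \<le> 2 ^ nat (depth v)"
    by (intro power_increasing) auto
  then show ?case by simp
next
  case (Suc n)
  show ?case
  proof (cases "depth v = 1")
    case False
    note w = parents_in_nodes[OF Suc.prems False]
    have "depth v = depth (left_parent v) + 1" "depth v = depth (right_parent v) + 1" "1 \<le> depth (left_parent v)"
      using w by (auto simp: depth_def left_parent_def right_parent_def nodes_def)
    then have "(2::real) ^ nat (depth v) = 2 * 2 ^ nat (depth (left_parent v))"
      and "depth (right_parent v) = depth (left_parent v)"
      by (auto simp: nat_add_distrib)
    then show ?thesis
      using False Suc.IH[OF w(1)] Suc.IH[OF w(2)]
        D_01[OF w(1) _ assms, of "Suc n"] D_01[OF w(2) _ assms, of "Suc n"]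
      by auto
  qed simp
qed

lemma total_measurable:
  assumes "v \<in> nodes"
  shows "total D v n \<in> borel_measurable (history M D n)"
  by (rule adapted_of_increments[OF total.simps]) (rule measurable_Suc[OF inflow_measurable[OF assms]])

lemma total_left_measurable:
  assumes "v \<in> nodes"
  shows "total_left D v n \<in> borel_measurable (history M D n)"
  by (rule adapted_of_increments[OF total_left.simps])
    (intro borel_measurable_times measurable_Suc inflow_measurable D_measurable_Suc assms)

lemma total_bounds:
  assumes "v \<in> nodes" and "\<omega> \<in> space M"
  shows "0 \<le> total_left D v n \<omega> \<and> total_left D v n \<omega> \<le> total D v n \<omega> \<and> real n \<le> total D v n \<omega>"
proof (induction n)
  case (Suc n)
  then show ?case
    using D_01[OF assms(1) _ assms(2), of "Suc n"] inflow_bounds[OF assms(2,1), of n] by auto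
qed simp

text \<open>The prescribed value 1/2 at time 0 equals \<open>\<eta> / (2 * \<eta>)\<close>, so one
  formula covers all times.\<close>

lemma prob_left_eq: "prob_left \<eta> D v n \<omega> = (total_left D v n \<omega> + \<eta>) / (total D v n \<omega> + 2 * \<eta>)"
  using eta_pos by (cases n) auto

lemma prob_left_bounds:
  assumes "v \<in> nodes" and "\<omega> \<in> space M"
  shows "0 \<le> prob_left \<eta> D v n \<omega> \<and> prob_left \<eta> D v n \<omega> \<le> 1"
  using total_bounds[OF assms, of n] eta_pos by (auto simp: prob_left_eq)

lemma prob_left_measurable:
  assumes "v \<in> nodes"
  shows "prob_left \<eta> D v n \<in> borel_measurable (history M D n)"
proof -
  note [measurable] = total_measurable[OF assms, of n] total_left_measurable[OF assms, of n]
  show ?thesis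
    unfolding prob_left_eq[abs_def] by measurable
qed

text \<open>This is the defining property of conditional expectation; boundedness of
  \<open>W\<close> supplies the integrability, and \<open>q\<close> needs to agree with the
  conditional probability only almost everywhere.\<close>

lemma expectation_cond_pr:
  assumes W: "W \<in> borel_measurable (history M D n)" "\<And>\<omega>. \<omega> \<in> space M \<Longrightarrow> \<bar>W \<omega>\<bar> \<le> c"
    and E: "E \<in> sets M" and q: "q \<in> borel_measurable M"
    and cond: "AE \<omega> in M. cond_pr M (history M D n) E \<omega> = q \<omega>"
  shows "expectation (\<lambda>\<omega>. W \<omega> * indicator E \<omega>) = expectation (\<lambda>\<omega>. W \<omega> * q \<omega>)"
proof -
  interpret finite_measure_subalgebra M "history M D n"
    by unfold_locales (rule subalgebra_history)
  note WM = measurable_M[OF W(1)]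
  have "integrable M (\<lambda>\<omega>. W \<omega> * indicator E \<omega>)"
    using E by (intro integrable_bounded_mult[OF WM W(2)]) (auto simp: indicator_def)
  then have "expectation (\<lambda>\<omega>. W \<omega> * indicator E \<omega>) =
      expectation (\<lambda>\<omega>. W \<omega> * real_cond_exp M (history M D n) (indicator E) \<omega>)"
    using W(1) E by (intro real_cond_exp_intg(2)[symmetric]) auto
  also have "\<dots> = expectation (\<lambda>\<omega>. W \<omega> * q \<omega>)"
    using cond WM q unfolding cond_pr_def by (intro integral_cong_AE) (auto elim: AE_mp)
  finally show ?thesis .
qed

lemma D_event:
  assumes "v \<in> nodes"
  shows "{\<omega> \<in> space M. D v (Suc n) \<omega> = 1} \<in> sets M"
proof -
  note [measurable] = D_measurable[OF assms, of "Suc n", simplified]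
  show ?thesis by measurable
qed

lemma predicts_D:
  assumes v: "v \<in> nodes"
  shows "predicts (prob_left \<eta> D v) (\<lambda>n. D v (Suc n))"
  unfolding predicts_def
proof (intro allI conjI impI ballI)
  fix n
  show "D v (Suc n) \<in> borel_measurable (history M D (Suc n))"
    by (rule D_measurable_Suc[OF v])
  show "prob_left \<eta> D v n \<in> borel_measurable (history M D n)"
    by (rule prob_left_measurable[OF v])
  show "D v (Suc n) \<omega> \<in> {0..1}" if "\<omega> \<in> space M" for \<omega>
    using D_01[OF v _ that, of "Suc n"] by auto
  show "prob_left \<eta> D v n \<omega> \<in> {0..1}" if "\<omega> \<in> space M" for \<omega>
    using prob_left_bounds[OF v that] by simp
  fix W :: "'a \<Rightarrow> real" and c
  assume W: "W \<in> borel_measurable (history M D n)" and bd: "\<forall>\<omega>\<in>space M. \<bar>W \<omega>\<bar> \<le> c"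
  \<comment> \<open>A variable with values in {0,1} is the indicator of its being 1, the event whose
    conditional probability the model prescribes.\<close>
  have "expectation (\<lambda>\<omega>. W \<omega> * D v (Suc n) \<omega>) =
      expectation (\<lambda>\<omega>. W \<omega> * indicator {\<omega> \<in> space M. D v (Suc n) \<omega> = 1} \<omega>)"
    by (rule Bochner_Integration.integral_cong) (use D_01[OF v, of "Suc n"] in \<open>fastforce simp: indicator_def\<close>)+
  also have "\<dots> = expectation (\<lambda>\<omega>. W \<omega> * prob_left \<eta> D v n \<omega>)"
    using D_cond_prob[OF v, of "Suc n"] bd
    by (intro expectation_cond_pr[OF W _ D_event[OF v] measurable_M[OF prob_left_measurable[OF v]]]) auto
  finally show "expectation (\<lambda>\<omega>. W \<omega> * D v (Suc n) \<omega>) = expectation (\<lambda>\<omega>. W \<omega> * prob_left \<eta> D v n \<omega>)" .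
qed

text \<open>Conditional independence enters here: for two distinct nodes the conditional probability
  of a joint left step factorizes.\<close>

lemma predicts_D_both:
  assumes v: "v \<in> nodes" and w: "w \<in> nodes" and vw: "v \<noteq> w"
  shows "predicts (\<lambda>n \<omega>. prob_left \<eta> D v n \<omega> * prob_left \<eta> D w n \<omega>)
    (\<lambda>n \<omega>. D v (Suc n) \<omega> * D w (Suc n) \<omega>)"
  unfolding predicts_def
proof (intro allI conjI impI ballI)
  fix n
  show "(\<lambda>\<omega>. D v (Suc n) \<omega> * D w (Suc n) \<omega>) \<in> borel_measurable (history M D (Suc n))"
    by (intro borel_measurable_times D_measurable_Suc v w)
  show q: "(\<lambda>\<omega>. prob_left \<eta> D v n \<omega> * prob_left \<eta> D w n \<omega>) \<in> borel_measurable (history M D n)"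
    by (intro borel_measurable_times prob_left_measurable v w)
  show "D v (Suc n) \<omega> * D w (Suc n) \<omega> \<in> {0..1}" if "\<omega> \<in> space M" for \<omega>
    using D_01[OF v _ that, of "Suc n"] D_01[OF w _ that, of "Suc n"] by auto
  show "prob_left \<eta> D v n \<omega> * prob_left \<eta> D w n \<omega> \<in> {0..1}" if "\<omega> \<in> space M" for \<omega>
    using prob_left_bounds[OF v that, of n] prob_left_bounds[OF w that, of n] by (auto intro: mult_le_one)
  fix W :: "'a \<Rightarrow> real" and c
  assume W: "W \<in> borel_measurable (history M D n)" and bd: "\<forall>\<omega>\<in>space M. \<bar>W \<omega>\<bar> \<le> c"
  let ?E = "{\<omega> \<in> space M. \<forall>u\<in>{v, w}. D u (Suc n) \<omega> \<in> {1}}"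
  have "?E = {\<omega> \<in> space M. D v (Suc n) \<omega> = 1} \<inter> {\<omega> \<in> space M. D w (Suc n) \<omega> = 1}"
    by auto
  then have E: "?E \<in> sets M"
    using D_event[OF v] D_event[OF w] by auto
  have "AE \<omega> in M. cond_pr M (history M D n) ?E \<omega> =
      (\<Prod>u\<in>{v, w}. cond_pr M (history M D n) {\<omega> \<in> space M. D u (Suc n) \<omega> \<in> {1}} \<omega>)"
    using D_cond_indep[of "Suc n", simplified, unfolded cond_indep_vars_def, THEN conjunct2,
        rule_format, of "{v, w}" "\<lambda>_. {1}"] v w by simp
  then have cond: "AE \<omega> in M. cond_pr M (history M D n) ?E \<omega> = prob_left \<eta> D v n \<omega> * prob_left \<eta> D w n \<omega>"
    using D_cond_prob[OF v, of "Suc n"] D_cond_prob[OF w, of "Suc n"] vw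
    by (auto elim!: AE_mp)
  have "expectation (\<lambda>\<omega>. W \<omega> * (D v (Suc n) \<omega> * D w (Suc n) \<omega>)) = expectation (\<lambda>\<omega>. W \<omega> * indicator ?E \<omega>)"
    by (rule Bochner_Integration.integral_cong)
      (use D_01[OF v, of "Suc n"] D_01[OF w, of "Suc n"] in \<open>fastforce simp: indicator_def\<close>)+
  also have "\<dots> = expectation (\<lambda>\<omega>. W \<omega> * (prob_left \<eta> D v n \<omega> * prob_left \<eta> D w n \<omega>))"
    using bd by (intro expectation_cond_pr[OF W _ E measurable_M[OF q] cond]) auto
  finally show "expectation (\<lambda>\<omega>. W \<omega> * (D v (Suc n) \<omega> * D w (Suc n) \<omega>)) =
      expectation (\<lambda>\<omega>. W \<omega> * (prob_left \<eta> D v n \<omega> * prob_left \<eta> D w n \<omega>))" .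
qed

section \<open>Limits of the proportions and of the averages\<close>

lemma AE_prob_left_limit:
  assumes v: "v \<in> nodes"
  shows "AE \<omega> in M. \<exists>p. 0 < p \<and> p < 1 \<and> (\<lambda>n. prob_left \<eta> D v n \<omega>) \<longlonglongrightarrow> p"
proof -
  \<comment> \<open>The draw with index \<open>n\<close> is the variable at time
    \<open>n + 1\<close>, predicted from the history up to \<open>n\<close>.\<close>
  interpret urn M "history M D" \<eta> "2 ^ nat (depth v) - 1" "inflow D v" "\<lambda>n. D v (Suc n)"
    "\<lambda>n \<omega>. total_left D v n \<omega> + \<eta>" "\<lambda>n \<omega>. total D v n \<omega> + 2 * \<eta>"
  proof
    show "predicts (\<lambda>n \<omega>. (total_left D v n \<omega> + \<eta>) / (total D v n \<omega> + 2 * \<eta>)) (\<lambda>n. D v (Suc n))"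
      using predicts_D[OF v] by (rule predicts_cong) (simp_all add: prob_left_eq)
  qed (use eta_pos inflow_measurable[OF v] inflow_bounds[OF _ v] D_01[OF v] in auto)
  show ?thesis
    using AE_fraction_limit_interior by (simp add: prob_left_eq)
qed

text \<open>Mass balance: \<open>v\<close> collects what its left parent sent right and what its
  right parent sent left, with a delay of one step. The initial inflow 1 and the unit added at each
  later step make up \<open>Suc n\<close>.\<close>

lemma total_Suc_eq:
  assumes "depth v \<noteq> 1"
  shows "total D v (Suc n) \<omega> = real (Suc n) +
    (total D (left_parent v) n \<omega> - total_left D (left_parent v) n \<omega>) + total_left D (right_parent v) n \<omega>"
  using assms by (induction n) (simp_all add: algebra_simps)

lemma total_left_average_convergent:
  assumes "convergent (\<lambda>n. total D v n \<omega> / real n)" and "convergent (\<lambda>n. prob_left \<eta> D v n \<omega>)"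
    and "v \<in> nodes" and "\<omega> \<in> space M"
  shows "convergent (\<lambda>n. total_left D v n \<omega> / real n)"
proof -
  obtain a p where a: "(\<lambda>n. total D v n \<omega> / real n) \<longlonglongrightarrow> a" and p: "(\<lambda>n. prob_left \<eta> D v n \<omega>) \<longlonglongrightarrow> p"
    using assms by (auto simp: convergent_def)
  \<comment> \<open>The identity also holds at \<open>n = 0\<close>, where all quotients by
    \<open>real n\<close> are 0.\<close>
  have "total_left D v n \<omega> / real n =
      prob_left \<eta> D v n \<omega> * (total D v n \<omega> / real n + 2 * \<eta> / real n) - \<eta> / real n" for n
  proof -
    have "total D v n \<omega> + 2 * \<eta> \<noteq> 0"
      using total_bounds[OF assms(3,4), of n] eta_pos by linarith
    then have "total_left D v n \<omega> = prob_left \<eta> D v n \<omega> * (total D v n \<omega> + 2 * \<eta>) - \<eta>"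
      by (simp add: prob_left_eq)
    then show ?thesis
      by (simp add: add_divide_distrib[symmetric] diff_divide_distrib)
  qed
  moreover have "(\<lambda>n. prob_left \<eta> D v n \<omega> * (total D v n \<omega> / real n + 2 * \<eta> / real n) - \<eta> / real n)
      \<longlonglongrightarrow> p * (a + 0) - 0"
    by (intro tendsto_intros a p lim_const_over_n)
  ultimately show ?thesis
    by (auto simp: convergent_def)
qed

lemma AE_total_average_convergent:
  "v \<in> nodes \<Longrightarrow> AE \<omega> in M. convergent (\<lambda>n. total D v n \<omega> / real n)"
proof (induction "nat (depth v)" arbitrary: v rule: less_induct)
  case less
  show ?case
  proof (cases "depth v = 1")
    case True
    have "inflow D v n \<omega> = 1" for n \<omega>
      using True by (cases n) auto
    then have "total D v n \<omega> = real n" for n \<omega>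
      by (induction n) auto
    moreover have "(\<lambda>n. real n / real n) \<longlonglongrightarrow> 1"
      by (rule tendsto_eventually) (use eventually_gt_at_top[of "0::nat"] in eventually_elim, simp)
    ultimately show ?thesis
      by (auto simp: convergent_def)
  next
    case False
    note w = parents_in_nodes[OF less.prems False]
    have "nat (depth (left_parent v)) < nat (depth v)" "nat (depth (right_parent v)) < nat (depth v)"
      using w by (auto simp: depth_def left_parent_def right_parent_def nodes_def)
    then have "AE \<omega> in M. convergent (\<lambda>n. total D (left_parent v) n \<omega> / real n)"
      and "AE \<omega> in M. convergent (\<lambda>n. total D (right_parent v) n \<omega> / real n)"
      using less.hyps w by auto
    with AE_space AE_prob_left_limit[OF w(1)] AE_prob_left_limit[OF w(2)] show ?thesis
    proof eventually_elim
      case (elim \<omega>)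
      let ?w1 = "left_parent v" and ?w2 = "right_parent v"
      have "convergent (\<lambda>n. total_left D ?w1 n \<omega> / real n)" "convergent (\<lambda>n. total_left D ?w2 n \<omega> / real n)"
        using elim w by (blast intro: total_left_average_convergent convergentI)+
      then obtain a b c where lims: "(\<lambda>n. total D ?w1 n \<omega> / real n) \<longlonglongrightarrow> a"
        "(\<lambda>n. total_left D ?w1 n \<omega> / real n) \<longlonglongrightarrow> b" "(\<lambda>n. total_left D ?w2 n \<omega> / real n) \<longlonglongrightarrow> c"
        using elim by (auto simp: convergent_def)
      \<comment> \<open>The factor n/(n+1) reconciles the parents' divisor \<open>n\<close> with the
        divisor \<open>n + 1\<close> of \<open>v\<close>.\<close>
      have "total D v (Suc n) \<omega> / real (Suc n) = 1 + real n / real (Suc n) *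
          (total D ?w1 n \<omega> / real n - total_left D ?w1 n \<omega> / real n + total_left D ?w2 n \<omega> / real n)" for n
        unfolding total_Suc_eq[OF False]
        by (cases "n = 0") (simp_all add: add_divide_distrib diff_divide_distrib distrib_left right_diff_distrib del: of_nat_Suc)
      moreover have "(\<lambda>n. 1 + real n / real (Suc n) * (total D ?w1 n \<omega> / real n
          - total_left D ?w1 n \<omega> / real n + total_left D ?w2 n \<omega> / real n)) \<longlonglongrightarrow> 1 + 1 * (a - b + c)"
        by (intro tendsto_intros lims LIMSEQ_n_over_Suc_n)
      ultimately have "(\<lambda>n. total D v (Suc n) \<omega> / real (Suc n)) \<longlonglongrightarrow> 1 + 1 * (a - b + c)"
        by simp
      then have "(\<lambda>n. total D v n \<omega> / real n) \<longlonglongrightarrow> 1 + 1 * (a - b + c)"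
        by (rule LIMSEQ_imp_Suc)
      then show ?case
        by (auto simp: convergent_def)
    qed
  qed
qed

text \<open>The bound \<open>1 \<le> a\<close> comes from an inflow of at least 1 per step. It keeps
  the limit away from 0, so that the reciprocal averages converge too.\<close>

lemma AE_average_flow_convergent:
  assumes "v \<in> nodes"
  shows "AE \<omega> in M. \<exists>a\<ge>1. (\<lambda>n. average_flow D v n \<omega>) \<longlonglongrightarrow> a"
  using AE_space AE_total_average_convergent[OF assms]
proof eventually_elim
  case (elim \<omega>)
  then obtain a where a: "(\<lambda>n. total D v n \<omega> / real n) \<longlonglongrightarrow> a"
    by (auto simp: convergent_def)
  have "average_flow D v (Suc n) \<omega> = total D v n \<omega> / real n * (real n / real (Suc n))" for n
    by (cases "n = 0") (simp_all add: average_flow_def)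
  moreover have "(\<lambda>n. total D v n \<omega> / real n * (real n / real (Suc n))) \<longlonglongrightarrow> a * 1"
    by (intro tendsto_mult a LIMSEQ_n_over_Suc_n)
  ultimately have "(\<lambda>n. average_flow D v (Suc n) \<omega>) \<longlonglongrightarrow> a"
    by simp
  then have lim: "(\<lambda>n. average_flow D v n \<omega>) \<longlonglongrightarrow> a"
    by (rule LIMSEQ_imp_Suc)
  have "real n / real (Suc n) \<le> average_flow D v (Suc n) \<omega>" for n
    using total_bounds[OF assms elim(1), of n] by (simp add: average_flow_def divide_right_mono)
  then have "1 \<le> a"
    by (intro LIMSEQ_le[OF LIMSEQ_n_over_Suc_n \<open>(\<lambda>n. average_flow D v (Suc n) \<omega>) \<longlonglongrightarrow> a\<close>]) auto
  with lim show ?case by blast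
qed

section \<open>Discordant parents and oscillation of the flood ratio\<close>

text \<open>The indicator of the event is \<open>D v - D v * D w\<close>. Its prediction tends to
  \<open>p * (1 - p')\<close>, which is positive because \<open>0 < p\<close> and
  \<open>p' < 1\<close>.\<close>

lemma AE_frequently_discordant:
  assumes v: "v \<in> nodes" and w: "w \<in> nodes" and "v \<noteq> w"
  shows "AE \<omega> in M. \<exists>\<^sub>F n in sequentially. D v (Suc n) \<omega> = 1 \<and> D w (Suc n) \<omega> = 0"
proof -
  have Z01: "D v (Suc n) \<omega> \<in> {0, 1}" "D w (Suc n) \<omega> \<in> {0, 1}" if "\<omega> \<in> space M" for n \<omega>
    using D_01 v w that by auto
  have "AE \<omega> in M. \<exists>\<^sub>F n in sequentially. D v (Suc n) \<omega> - D v (Suc n) \<omega> * D w (Suc n) \<omega> = 1"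
  proof (rule AE_frequently_of_predicts)
    show "predicts (\<lambda>n \<omega>. prob_left \<eta> D v n \<omega> - prob_left \<eta> D v n \<omega> * prob_left \<eta> D w n \<omega>)
        (\<lambda>n \<omega>. D v (Suc n) \<omega> - D v (Suc n) \<omega> * D w (Suc n) \<omega>)"
    proof (rule predicts_diff[OF predicts_D[OF v] predicts_D_both[OF assms]])
      fix n \<omega> assume \<omega>: "\<omega> \<in> space M"
      show "D v (Suc n) \<omega> * D w (Suc n) \<omega> \<le> D v (Suc n) \<omega>"
        using Z01[OF \<omega>, of n] by auto
      show "prob_left \<eta> D v n \<omega> * prob_left \<eta> D w n \<omega> \<le> prob_left \<eta> D v n \<omega>"
        using prob_left_bounds[OF v \<omega>, of n] prob_left_bounds[OF w \<omega>, of n] by (simp add: mult_left_le)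
    qed
    show "D v (Suc n) \<omega> - D v (Suc n) \<omega> * D w (Suc n) \<omega> \<in> {0, 1}" if "\<omega> \<in> space M" for n \<omega>
      using Z01[OF that, of n] by auto
    show "AE \<omega> in M. \<exists>p>0. (\<lambda>n. prob_left \<eta> D v n \<omega> - prob_left \<eta> D v n \<omega> * prob_left \<eta> D w n \<omega>) \<longlonglongrightarrow> p"
      using AE_prob_left_limit[OF v] AE_prob_left_limit[OF w]
    proof eventually_elim
      case (elim \<omega>)
      then obtain p p' where p: "0 < p" "p < 1" "(\<lambda>n. prob_left \<eta> D v n \<omega>) \<longlonglongrightarrow> p"
        and p': "0 < p'" "p' < 1" "(\<lambda>n. prob_left \<eta> D w n \<omega>) \<longlonglongrightarrow> p'"
        by blast
      have "(\<lambda>n. prob_left \<eta> D v n \<omega> - prob_left \<eta> D v n \<omega> * prob_left \<eta> D w n \<omega>) \<longlonglongrightarrow> p - p * p'"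
        by (intro tendsto_intros p p')
      moreover have "0 < p - p * p'"
        using p p' by simp
      ultimately show ?case by blast
    qed
  qed
  with AE_space show ?thesis
  proof eventually_elim
    case (elim \<omega>)
    show ?case
      using elim(2) by (rule frequently_elim1) (metis Z01[OF elim(1)] diff_self diff_zero insertE
          mult_1 mult_zero_left singletonD zero_neq_one)
  qed
qed

lemma AE_flood_ratio_oscillates:
  assumes v: "v \<in> nodes" and depth: "2 \<le> depth v"
  shows "AE \<omega> in M. liminf (\<lambda>n. ereal (flood_ratio D v n \<omega>)) < limsup (\<lambda>n. ereal (flood_ratio D v n \<omega>))"
proof -
  have nontop: "depth v \<noteq> 1"
    using depth by simp
  note w = parents_in_nodes[OF v nontop]
  have ne: "left_parent v \<noteq> right_parent v"
    by (simp add: left_parent_def right_parent_def)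
  show ?thesis
    using AE_space AE_average_flow_convergent[OF v]
      AE_frequently_discordant[OF w ne] AE_frequently_discordant[OF w(2,1) ne[symmetric]]
  proof eventually_elim
    case (elim \<omega>)
    then obtain a where a: "1 \<le> a" "(\<lambda>n. average_flow D v n \<omega>) \<longlonglongrightarrow> a"
      by blast
    have "(\<lambda>n. 1 / average_flow D v n \<omega>) \<longlonglongrightarrow> 1 / a"
      using a by (intro tendsto_intros) auto
    then have lim: "(\<lambda>n. 1 / average_flow D v (Suc n) \<omega>) \<longlonglongrightarrow> 1 / a"
      by (rule LIMSEQ_Suc)
    \<comment> \<open>Both parents send their flow away from \<open>v\<close>, leaving only the
      added unit.\<close>
    have low: "\<exists>\<^sub>F n in sequentially. inflow D v (Suc n) \<omega> = 1"
      using elim(3) by (rule frequently_elim1) (simp add: nontop)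
    \<comment> \<open>Both parents send their flow, at least 1 each, to \<open>v\<close>, which adds
      one unit.\<close>
    have high: "\<exists>\<^sub>F n in sequentially. 3 \<le> inflow D v (Suc n) \<omega>"
    proof (rule frequently_elim1[OF elim(4)])
      fix n assume "D (right_parent v) (Suc n) \<omega> = 1 \<and> D (left_parent v) (Suc n) \<omega> = 0"
      then show "3 \<le> inflow D v (Suc n) \<omega>"
        using inflow_bounds[OF elim(1) w(1), of n] inflow_bounds[OF elim(1) w(2), of n] by (simp add: nontop)
    qed
    have ratio: "flood_ratio D v n \<omega> = inflow D v n \<omega> * (1 / average_flow D v n \<omega>)" for n
      by (simp add: flood_ratio_def)
    \<comment> \<open>At times with inflow 1 the ratio is close to \<open>1 / a\<close>, and with
      inflow at least 3 it is nearly \<open>3 / a\<close> or more. The thresholds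
      \<open>4 / 3 / a\<close> and \<open>2 / a\<close> lie strictly between and leave room for the
      error in the average.\<close>
    have "liminf (\<lambda>n. ereal (flood_ratio D v n \<omega>)) \<le> ereal (4 / 3 / a)"
    proof (rule ccontr)
      assume "\<not> ?thesis"
      then have "\<forall>\<^sub>F n in sequentially. ereal (4 / 3 / a) < ereal (flood_ratio D v n \<omega>)"
        by (intro less_LiminfD) simp
      then have "\<forall>\<^sub>F n in sequentially. 4 / 3 / a < flood_ratio D v (Suc n) \<omega>"
        by (subst (asm) eventually_sequentially_Suc[symmetric]) simp
      moreover have "\<forall>\<^sub>F n in sequentially. 1 / average_flow D v (Suc n) \<omega> < 4 / 3 / a"
        using lim a by (intro order_tendstoD) (auto simp: field_simps)
      ultimately have "\<forall>\<^sub>F n in sequentially. inflow D v (Suc n) \<omega> \<noteq> 1"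
        by eventually_elim (auto simp: ratio simp del: inflow.simps)
      with low show False
        by (simp add: frequently_def)
    qed
    also have "ereal (4 / 3 / a) < ereal (2 / a)"
      using a by (simp add: field_simps)
    also have "ereal (2 / a) \<le> limsup (\<lambda>n. ereal (flood_ratio D v n \<omega>))"
    proof (rule ccontr)
      assume "\<not> ?thesis"
      then have "\<forall>\<^sub>F n in sequentially. ereal (flood_ratio D v n \<omega>) < ereal (2 / a)"
        by (intro Limsup_lessD) simp
      then have "\<forall>\<^sub>F n in sequentially. flood_ratio D v (Suc n) \<omega> < 2 / a"
        by (subst (asm) eventually_sequentially_Suc[symmetric]) simp
      \<comment> \<open>The factor 2/3 is chosen so that an inflow of 3 brings the ratio to the
        threshold \<open>2 / a\<close>.\<close>
      moreover have "\<forall>\<^sub>F n in sequentially. 2 / 3 / a < 1 / average_flow D v (Suc n) \<omega>"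
        using lim a by (intro order_tendstoD) (auto simp: field_simps)
      ultimately have "\<forall>\<^sub>F n in sequentially. \<not> 3 \<le> inflow D v (Suc n) \<omega>"
      proof eventually_elim
        case *: (elim n)
        show ?case
        proof
          assume "3 \<le> inflow D v (Suc n) \<omega>"
          then have "3 * (2 / 3 / a) \<le> inflow D v (Suc n) \<omega> * (1 / average_flow D v (Suc n) \<omega>)"
            using * a by (intro mult_mono) auto
          then show False
            using * unfolding ratio by simp
        qed
      qed
      with high show False
        by (simp add: frequently_def)
    qed
    finally show ?case .
  qed
qed

end

theorem proposition3p17:
  fixes M :: "'a measure" and \<eta> :: real and D :: "node \<Rightarrow> nat \<Rightarrow> 'a \<Rightarrow> real" and v :: node
  assumes "erosion_network M \<eta> D"
    and "v \<in> nodes" and "depth v \<ge> 2"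
  shows "(AE \<omega> in M. convergent (\<lambda>n. average_flow D v n \<omega>)) \<and>
         (AE \<omega> in M. liminf (\<lambda>n. ereal (flood_ratio D v n \<omega>))
                   < limsup (\<lambda>n. ereal (flood_ratio D v n \<omega>)))"
proof -
  interpret erosion_network M \<eta> D
    by (rule assms)
  have "AE \<omega> in M. convergent (\<lambda>n. average_flow D v n \<omega>)"
    using AE_average_flow_convergent[OF assms(2)] by eventually_elim (auto simp: convergent_def)
  then show ?thesis
    using AE_flood_ratio_oscillates[OF assms(2,3)] by blast
qed

end
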